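(* Let $a \ge 2$ be an integer. Then there exist positive integers $b, c, d$ such that \[ \frac{5}{a}=\frac{1}{b}+\frac{1}{c}+\frac{1}{d} \] in each of the following cases, where $q$ is a positive integer: \begin{enumerate} \item[(1)] $a = 5q+i$ with $i \in \{0,2,3,4\}$; \item[(2)] $a = 5q+1$ with $q \not\equiv 0 \pmod{12}$; \item[(3)] $a = 5q+1$ with $q = 12u$, $u \ge 1$, where $u = 7v+i$ for some integer $v \ge 0$ and some $i \in \{1,2,3,4,5,6\}$; \item[(4)] $a = 5q+1$ with $q = 84v$ (that is, $q=12u$ with $u=7v$), where $v = 3w+i$ for some integer $w \ge 0$ and some $i \in \{1,2\}$. \end{enumerate} *)

theory Defs
  imports Complex_Main
begin

end

theory Submission
  imports Defs
begin

text \<open>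
  Choose a first denominator \<open>b\<close> slightly larger than \<open>a / 5\<close>.  The remainder
  \<open>5 / a - 1 / b\<close> equals \<open>k / (a * b)\<close> with a small numerator \<open>k = 5 * b - a\<close>, and \<open>k / N\<close> is a
  sum of two unit fractions as soon as \<open>N\<close> has two positive divisors whose sum is a multiple
  of \<open>k\<close> (lemma \<open>unit_fractions_of_divisors\<close>).  Everything thus reduces to finding a suitable \<open>b\<close>
  and two such divisors of \<open>a * b\<close>.

  Taking \<open>b = q + 1\<close> makes \<open>k = 5 - i\<close> when \<open>a = 5 * q + i\<close>.  This settles all residues \<open>i \<noteq> 1\<close> at
  once; for \<open>i = 1\<close>, where \<open>k = 4\<close>, it needs either \<open>4\<close> dividing \<open>a * b\<close> or a divisor of
  \<open>a * b\<close> congruent to \<open>3\<close> modulo \<open>4\<close>, and one is visible unless \<open>12\<close> divides \<open>q\<close>.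
  For \<open>q = 12 * u\<close> the prime \<open>7\<close> is such a divisor if \<open>u\<close> is \<open>4\<close> or \<open>5\<close> modulo \<open>7\<close>, and the
  other nonzero residues modulo \<open>7\<close> are reached by \<open>b = q + 3\<close>, where \<open>k = 14\<close>.  For \<open>q = 84 * v\<close> the
  choice \<open>b = q + 2\<close>, where \<open>k = 9\<close>, succeeds for \<open>v\<close> not divisible by \<open>3\<close>.
\<close>

text \<open>
  If \<open>d + e = (n * b - a) * m\<close> and \<open>d\<close>, \<open>e\<close> divide \<open>a * b\<close>, then dividing by \<open>a * b * m\<close> turns
  \<open>n / a - 1 / b\<close> into \<open>d / (a * b * m) + e / (a * b * m)\<close>, and both of these are unit fractions.
\<close>

lemma unit_fractions_of_divisors:
  fixes n a b d e :: int
  assumes pos: "a > 0" "b > 0" "d > 0" "e > 0" "n * b - a > 0"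
    and dvd: "d dvd a * b" "e dvd a * b" "n * b - a dvd d + e"
  shows "\<exists>x y z :: int. x > 0 \<and> y > 0 \<and> z > 0 \<and>
    rat_of_int n / rat_of_int a = 1 / rat_of_int x + 1 / rat_of_int y + 1 / rat_of_int z"
proof -
  obtain f where f: "a * b = d * f" using dvd(1) by blast
  obtain g where g: "a * b = e * g" using dvd(2) by blast
  obtain m where m: "d + e = (n * b - a) * m" using dvd(3) by blast
  have "d * f > 0" "e * g > 0" "(n * b - a) * m > 0"
    using pos f g m by (metis mult_pos_pos, metis mult_pos_pos, linarith)
  then have fgm: "f > 0" "g > 0" "m > 0"
    using pos by (auto simp: zero_less_mult_iff)
  let ?r = rat_of_int
  have f': "?r a * ?r b = ?r d * ?r f" and g': "?r a * ?r b = ?r e * ?r g"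
    and m': "?r d + ?r e = (?r n * ?r b - ?r a) * ?r m"
    using f g m by (metis of_int_mult, metis of_int_mult, metis of_int_add of_int_diff of_int_mult)
  have nz: "?r a \<noteq> 0" "?r b \<noteq> 0" "?r d \<noteq> 0" "?r e \<noteq> 0" "?r f \<noteq> 0" "?r g \<noteq> 0" "?r m \<noteq> 0"
    using pos fgm by auto
  have "1 / ?r (f * m) = ?r d / (?r a * ?r b * ?r m)"
    using nz by (simp add: f')
  moreover have "1 / ?r (g * m) = ?r e / (?r a * ?r b * ?r m)"
    using nz by (simp add: g')
  ultimately have "1 / ?r (f * m) + 1 / ?r (g * m) = (?r d + ?r e) / (?r a * ?r b * ?r m)"
    by (simp add: add_divide_distrib)
  also have "\<dots> = (?r n * ?r b - ?r a) / (?r a * ?r b)"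
    using nz by (simp add: m')
  also have "\<dots> = ?r n / ?r a - 1 / ?r b"
    using nz by (simp add: field_simps)
  finally have "?r n / ?r a = 1 / ?r b + 1 / ?r (f * m) + 1 / ?r (g * m)"
    by simp
  moreover have "f * m > 0" "g * m > 0" using fgm by simp_all
  ultimately show ?thesis using pos(2) by blast
qed

theorem theorem2p1:
  fixes a q :: int
  assumes "a \<ge> 2" and "q > 0"
    and "(\<exists>i\<in>{0, 2, 3, 4}. a = 5 * q + i)
      \<or> (a = 5 * q + 1 \<and> q mod 12 \<noteq> 0)
      \<or> (a = 5 * q + 1 \<and>
          (\<exists>u v i. u \<ge> 1 \<and> v \<ge> 0 \<and> i \<in> {1, 2, 3, 4, 5, 6} \<and> q = 12 * u \<and> u = 7 * v + i))
      \<or> (a = 5 * q + 1 \<and>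
          (\<exists>v w i. w \<ge> 0 \<and> i \<in> {1, 2} \<and> q = 84 * v \<and> v = 3 * w + i))"
  shows "\<exists>b c d :: int. b > 0 \<and> c > 0 \<and> d > 0 \<and>
    5 / rat_of_int a = 1 / rat_of_int b + 1 / rat_of_int c + 1 / rat_of_int d"
    (is ?goal)
proof -
  have witness: ?goal
    if "b > 0" "d > 0" "e > 0" "5 * b - a > 0" "d dvd a * b" "e dvd a * b" "5 * b - a dvd d + e"
    for b d e
    using unit_fractions_of_divisors[of a b d e 5] that assms(1) by simp
  consider (i0) "a = 5 * q" | (i2) "a = 5 * q + 2" | (i3) "a = 5 * q + 3" | (i4) "a = 5 * q + 4"
    | (i1) "a = 5 * q + 1" "q mod 12 \<noteq> 0"
    | (seven) u where "a = 5 * q + 1" "q = 12 * u" "u mod 7 \<in> {1, 2, 3, 4, 5, 6}"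
    | (three) v where "a = 5 * q + 1" "q = 84 * v" "v mod 3 \<in> {1, 2}"
    using assms(3)
  proof (elim disjE)
    assume "\<exists>i\<in>{0, 2, 3, 4}. a = 5 * q + i"
    then show thesis using i0 i2 i3 i4 by auto
  next
    assume "a = 5 * q + 1 \<and> q mod 12 \<noteq> 0"
    then show thesis using i1 by blast
  next
    assume "a = 5 * q + 1 \<and>
      (\<exists>u v i. u \<ge> 1 \<and> v \<ge> 0 \<and> i \<in> {1, 2, 3, 4, 5, 6} \<and> q = 12 * u \<and> u = 7 * v + i)"
    then obtain u v i where "a = 5 * q + 1" "q = 12 * u" "u = 7 * v + i" "i \<in> {1, 2, 3, 4, 5, 6}"
      by blast
    then show thesis by (intro seven[of u]) auto
  next
    assume "a = 5 * q + 1 \<and>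
      (\<exists>v w i. w \<ge> 0 \<and> i \<in> {1, 2} \<and> q = 84 * v \<and> v = 3 * w + i)"
    then obtain v w i where "a = 5 * q + 1" "q = 84 * v" "v = 3 * w + i" "i \<in> {1, 2}"
      by blast
    then show thesis by (intro three[of v]) auto
  qed
  then show ?goal
  proof cases
    case i0
    show ?goal by (rule witness[of "q + 1" 5 5]) (use i0 assms in simp_all)
  next
    case i2
    \<comment> \<open>\<open>5 * q + 2\<close> and \<open>q + 1\<close> have opposite parity, so \<open>2\<close> divides their product.\<close>
    show ?goal by (rule witness[of "q + 1" 1 2]) (use i2 assms in simp_all)
  next
    case i3
    show ?goal by (rule witness[of "q + 1" 1 1]) (use i3 assms in simp_all)
  next
    case i4
    show ?goal by (rule witness[of "q + 1" 1 1]) (use i4 assms in simp_all)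
  next
    case i1
    \<comment> \<open>The numerator is \<open>4\<close>.  For even \<open>q\<close> the product \<open>a * (q + 1)\<close> is odd, and a divisor
      congruent to \<open>3\<close> modulo \<open>4\<close> pairs with \<open>1\<close>: the factor \<open>q + 1\<close> itself, or \<open>3\<close>.\<close>
    consider "odd q" | "q mod 4 = 2" | "q mod 3 = 1" | "q mod 3 = 2"
    proof -
      have "odd q \<or> q mod 4 = 2 \<or> 4 dvd q" by presburger
      moreover have "q mod 3 = 1 \<or> q mod 3 = 2 \<or> 3 dvd q" by presburger
      moreover have "4 dvd q \<Longrightarrow> 3 dvd q \<Longrightarrow> q mod 12 = 0" by presburger
      ultimately have "odd q \<or> q mod 4 = 2 \<or> q mod 3 = 1 \<or> q mod 3 = 2" using i1(2) by blast
      then show thesis using that by blast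
    qed
    then show ?goal
    proof cases
      case 1
      then have "2 dvd a * (q + 1)" by simp
      then show ?goal by (intro witness[of "q + 1" 2 2]) (use i1 assms in simp_all)
    next
      case 2
      then have "4 dvd 1 + (q + 1)" by presburger
      then show ?goal by (intro witness[of "q + 1" 1 "q + 1"]) (use i1 assms in simp_all)
    next
      case 3
      then obtain t where "q = 3 * t + 1" by (metis mult_div_mod_eq)
      then have "3 dvd a" by (intro dvdI[of _ _ "5 * t + 2"]) (simp add: i1(1))
      then show ?goal by (intro witness[of "q + 1" 1 3]) (use i1 assms in simp_all)
    next
      case 4
      then have "3 dvd q + 1" by presburger
      then show ?goal by (intro witness[of "q + 1" 1 3]) (use i1 assms in simp_all)
    qed
  next
    case seven
    have a: "a = 60 * u + 1" using seven by simp
    have u: "u > 0" using seven assms(2) by simp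
    \<comment> \<open>If \<open>7\<close> divides \<open>a * (12 * u + 1)\<close>, the pair \<open>1\<close>, \<open>7\<close> serves the numerator \<open>4\<close>.  Otherwise
      the first denominator is \<open>12 * u + 3\<close>, with numerator \<open>14\<close>; then \<open>a * (12 * u + 3)\<close> is odd,
      so any two of its divisors have an even sum and only opposite residues modulo \<open>7\<close> are sought.
      They are found among the products of \<open>3\<close>, \<open>4 * u + 1\<close> and \<open>a\<close>.\<close>
    consider "u mod 7 = 1" | "u mod 7 = 2" | "u mod 7 = 3" | "u mod 7 = 4"
      | "u mod 7 = 5" | "u mod 7 = 6"
      using seven(3) by auto
    then show ?goal
    proof cases
      case 1
      then obtain t where t: "u = 7 * t + 1" by (metis mult_div_mod_eq)
      have "3 + a * (4 * u + 1) = 14 * (840 * t\<^sup>2 + 272 * t + 22)"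
        unfolding a t by (simp add: power2_eq_square algebra_simps)
      then have "14 dvd 3 + a * (4 * u + 1)" by simp
      moreover have "3 dvd a * (12 * u + 3)" by (intro dvd_mult dvdI[of _ _ "4 * u + 1"]) simp
      moreover have "a * (4 * u + 1) dvd a * (12 * u + 3)"
        by (intro mult_dvd_mono dvd_refl dvdI[of _ _ 3]) simp
      ultimately show ?goal
        by (intro witness[of "12 * u + 3" 3 "a * (4 * u + 1)"]) (use a u in simp_all)
    next
      case 2
      then obtain t where t: "u = 7 * t + 2" by (metis mult_div_mod_eq)
      have "14 dvd 1 + (12 * u + 3)" by (intro dvdI[of _ _ "6 * t + 2"]) (simp add: t)
      then show ?goal by (intro witness[of "12 * u + 3" 1 "12 * u + 3"]) (use a u in simp_all)
    next
      case 3
      then obtain t where t: "u = 7 * t + 3" by (metis mult_div_mod_eq)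
      have "14 dvd 1 + (4 * u + 1)" by (intro dvdI[of _ _ "2 * t + 1"]) (simp add: t)
      moreover have "4 * u + 1 dvd a * (12 * u + 3)"
        by (intro dvd_mult dvdI[of _ _ 3]) simp
      ultimately show ?goal by (intro witness[of "12 * u + 3" 1 "4 * u + 1"]) (use a u in simp_all)
    next
      case 4
      then obtain t where t: "u = 7 * t + 4" by (metis mult_div_mod_eq)
      have "7 dvd 12 * u + 1" by (intro dvdI[of _ _ "12 * t + 7"]) (simp add: t)
      then show ?goal by (intro witness[of "12 * u + 1" 1 7]) (use a u in simp_all)
    next
      case 5
      then obtain t where t: "u = 7 * t + 5" by (metis mult_div_mod_eq)
      have "7 dvd a" by (intro dvdI[of _ _ "60 * t + 43"]) (simp add: a t)
      then show ?goal by (intro witness[of "12 * u + 1" 1 7]) (use a u in simp_all)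
    next
      case 6
      then obtain t where t: "u = 7 * t + 6" by (metis mult_div_mod_eq)
      have "14 dvd 3 + (4 * u + 1)" by (intro dvdI[of _ _ "2 * t + 2"]) (simp add: t)
      moreover have "3 dvd a * (12 * u + 3)" by (intro dvd_mult dvdI[of _ _ "4 * u + 1"]) simp
      moreover have "4 * u + 1 dvd a * (12 * u + 3)"
        by (intro dvd_mult dvdI[of _ _ 3]) simp
      ultimately show ?goal by (intro witness[of "12 * u + 3" 3 "4 * u + 1"]) (use a u in simp_all)
    qed
  next
    case three
    have a: "a = 420 * v + 1" using three by simp
    have v: "v > 0" using three assms(2) by simp
    consider "v mod 3 = 1" | "v mod 3 = 2" using three(3) by auto
    then show ?goal
    proof cases
      case 1
      then obtain t where t: "v = 3 * t + 1" by (metis mult_div_mod_eq)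
      have "9 dvd 2 + a" by (intro dvdI[of _ _ "140 * t + 47"]) (simp add: a t)
      moreover have "2 dvd a * (84 * v + 2)" by simp
      ultimately show ?goal by (intro witness[of "84 * v + 2" 2 a]) (use a v in simp_all)
    next
      case 2
      then obtain t where t: "v = 3 * t + 2" by (metis mult_div_mod_eq)
      have "9 dvd 1 + (84 * v + 2)" by (intro dvdI[of _ _ "28 * t + 19"]) (simp add: t)
      then show ?goal by (intro witness[of "84 * v + 2" 1 "84 * v + 2"]) (use a v in simp_all)
    qed
  qed
qed

end
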